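(* For all integers $k\geq 0$ and $n\geq 1$, $$\binom{n+k}{k}B_{n}^{(-k)}=S(n+k,k)$$ and $$\sum_{i=0}^{n}\binom{n+k}{n-i}\binom{i+k}{i}B_{n-i}^{(k)}B_{i}^{(-k)}=0,$$ where $B_j^{(m)}$ are the generalized Bernoulli numbers and $S(\cdot,\cdot)$ the Stirling numbers of the second kind.
   Context: For any integer $m$, the generalized Bernoulli numbers $B_n^{(m)}$ are defined by the formal power series identity $\left(1+\sum_{n\geq 1}\frac{1}{(n+1)!}X^{n}\right)^{-m}=1+\sum_{n\geq 1}\frac{1}{n!}B_{n}^{(m)}X^{n}$, with $B_0^{(m)}=1$. The Stirling numbers of the second kind $S(n,k)$ are defined by $\frac{1}{k!}\left(\sum_{n\geq 1}\frac{1}{n!}X^{n}\right)^{k}=\sum_{n\geq k}\frac{1}{n!}S(n,k)X^{n}$. *)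

theory Defs
  imports
    "HOL-Computational_Algebra.Formal_Power_Series"
    "HOL-Combinatorics.Stirling"
begin

text \<open>
  The base series is (exp X - 1) / X, with constant coefficient 1, so its library inverse is a
  genuine multiplicative inverse and integer powers of it have their usual meaning.
\<close>
definition gen_bernoulli :: "int \<Rightarrow> nat \<Rightarrow> rat" where
  "gen_bernoulli m n =
     fact n * fps_nth (Abs_fps (\<lambda>j. 1 / fact (j + 1) :: rat) powi (- m)) n"

lemma gen_bernoulli_base_split:
  "Abs_fps (\<lambda>j. 1 / fact (j + 1) :: rat) =
     1 + Abs_fps (\<lambda>j. if j = 0 then 0 else 1 / fact (j + 1))"
  by (rule fps_ext) simp

lemma gen_bernoulli_series:
  "Abs_fps (\<lambda>j. 1 / fact (j + 1) :: rat) powi (- m) =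
     Abs_fps (\<lambda>n. 1 / fact n * gen_bernoulli m n)"
  by (rule fps_ext) (simp add: gen_bernoulli_def)

lemma gen_bernoulli_0: "gen_bernoulli m 0 = 1"
  by (simp add: gen_bernoulli_def power_int_def fps_nth_power_0)

text \<open>
  Stirling numbers of the second kind are the library's \<^const>\<open>Stirling\<close>, which is defined by
  recursion; the following lemma shows that it satisfies the generating function identity that
  is also used to define these numbers. The sum starts at n = k there: \<^const>\<open>Stirling\<close>
  vanishes for n < k.
\<close>
lemma Stirling_egf:
  "fps_const (1 / fact k) * Abs_fps (\<lambda>n. if n = 0 then 0 else 1 / fact n) ^ k =
     Abs_fps (\<lambda>n. if n < k then 0 else 1 / fact n * (of_nat (Stirling n k) :: rat))"
proof -
  let ?f = "fps_exp (1 :: rat) - 1"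
  define g where "g k = fps_const (1 / fact k) * ?f ^ k" for k
  have f: "Abs_fps (\<lambda>n. if n = 0 then 0 else 1 / fact n) = ?f"
    by (rule fps_ext) simp
  have deriv: "fps_deriv (g (Suc k)) = of_nat (Suc k) * g (Suc k) + g k" for k
  proof -
    have c: "of_nat (Suc k) * fps_const (1 / fact (Suc k)) = fps_const (1 / fact k :: rat)"
      by (simp add: fps_of_nat[symmetric] del: of_nat_Suc)
    have "fps_deriv (?f ^ Suc k) = of_nat (Suc k) * (fps_exp 1 * ?f ^ k)"
      unfolding fps_deriv_power by (simp add: fps_of_nat[symmetric] mult.assoc del: of_nat_Suc power_Suc)
    then have "fps_deriv (g (Suc k)) =
        (of_nat (Suc k) * fps_const (1 / fact (Suc k))) * ((?f + 1) * ?f ^ k)"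
      unfolding g_def by (simp del: of_nat_Suc fact_Suc power_Suc)
    also have "\<dots> = of_nat (Suc k) * (fps_const (1 / fact (Suc k)) * ?f ^ Suc k)
        + (of_nat (Suc k) * fps_const (1 / fact (Suc k))) * ?f ^ k"
      by (simp add: algebra_simps del: of_nat_Suc fact_Suc)
    finally show ?thesis
      unfolding c g_def .
  qed
  have "fps_nth (g k) n = of_nat (Stirling n k) / fact n" for n
  proof (induction n arbitrary: k)
    case 0
    show ?case by (cases k) (simp_all add: g_def fps_nth_power_0)
  next
    case (Suc n)
    show ?case
    proof (cases k)
      case 0
      then show ?thesis by (simp add: g_def)
    next
      case k: (Suc l)
      have "of_nat (Suc n) * fps_nth (g k) (Suc n) = fps_nth (fps_deriv (g k)) n"
        by (simp add: fps_deriv_nth)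
      also have "\<dots> = of_nat (Suc l) * fps_nth (g k) n + fps_nth (g l) n"
        unfolding k deriv by (simp add: fps_of_nat[symmetric] del: of_nat_Suc)
      also have "\<dots> = of_nat (Stirling (Suc n) k) / fact n"
        by (simp add: Suc.IH k add_divide_distrib distrib_right)
      finally show ?thesis by (simp add: field_simps del: of_nat_Suc)
    qed
  qed
  then show ?thesis
    unfolding f by (intro fps_ext) (simp add: g_def)
qed

end

theory Submission imports Defs begin

text \<open>
  Let F be the series (exp X - 1) / X, so that B(m, n) is n! times the coefficient of X^n in
  F^(-m). Both identities are comparisons of coefficients.

  Since X F = exp X - 1, the series F^k is (exp X - 1)^k with all exponents lowered by k, and
  (exp X - 1)^k / k! is the exponential generating function of the Stirling numbers S(_, k);
  this is the lemma \<open>fps_nth_base_power\<close>, and the first identity is this lemma after clearing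
  factorials.

  For the second identity, the product of the two binomial coefficients is a constant
  independent of i times the single coefficient (n choose i). Up to that constant the sum is
  therefore the binomial convolution of the sequences B(k, _) and B(-k, _), that is, n! times the
  coefficient of X^n in F^(-k) F^k = 1.
\<close>

text \<open>
  The factor X^k moves the coefficient of X^n in F^k to that of X^(n+k) in (exp X - 1)^k, whose
  coefficients are Stirling numbers.
\<close>
lemma fps_nth_base_power:
  "fps_nth (Abs_fps (\<lambda>j. 1 / fact (j + 1) :: rat) ^ k) n =
     fact k / fact (n + k) * of_nat (Stirling (n + k) k)"
proof -
  let ?F = "Abs_fps (\<lambda>j. 1 / fact (j + 1) :: rat)"
  let ?E = "Abs_fps (\<lambda>n. if n = 0 then 0 else 1 / fact n) :: rat fps"
  have shift: "fps_X * ?F = ?E"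
    by (rule fps_ext) (simp del: fact_Suc)
  have "fps_nth (?F ^ k) n = fps_nth (?E ^ k) (n + k)"
    unfolding shift[symmetric] power_mult_distrib by (simp only: fps_X_power_mult_nth) simp
  moreover have "1 / fact k * fps_nth (?E ^ k) (n + k) =
      1 / fact (n + k) * of_nat (Stirling (n + k) k)"
    using arg_cong[OF Stirling_egf[of k], of "\<lambda>f. fps_nth f (n + k)"] by simp
  ultimately show ?thesis
    by (simp add: field_simps)
qed

lemma binomial_gen_bernoulli_eq_Stirling:
  "of_nat ((n + k) choose k) * gen_bernoulli (- int k) n = of_nat (Stirling (n + k) k)"
proof -
  have "gen_bernoulli (- int k) n = fact n * fact k / fact (n + k) * of_nat (Stirling (n + k) k)"
    by (simp only: gen_bernoulli_def minus_minus power_int_of_nat fps_nth_base_power) simp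
  moreover have "(of_nat ((n + k) choose k) :: rat) = fact (n + k) / (fact k * fact n)"
    by (simp add: binomial_fact)
  ultimately show ?thesis
    by simp
qed

text \<open>
  The sequences of orders m and -m are inverse to each other under binomial convolution, because
  their exponential generating functions F^(-m) and F^m are inverse power series.
\<close>
lemma gen_bernoulli_convolution_eq_0:
  assumes "n \<ge> 1"
  shows "(\<Sum>i = 0..n. of_nat (n choose i) * gen_bernoulli m (n - i) * gen_bernoulli (- m) i) = 0"
proof -
  let ?F = "Abs_fps (\<lambda>j. 1 / fact (j + 1) :: rat)"
  have "inverse ?F * ?F = 1"
    by (rule inverse_mult_eq_1) simp
  (* Formal power series over a field are not a division ring, so the exponent law is derived
     from the invertibility of F. *)
  then have inv: "?F powi m * ?F powi (- m) = 1"
    by (simp add: power_int_def mult.commute flip: power_mult_distrib)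
  have "(\<Sum>i = 0..n. of_nat (n choose i) * gen_bernoulli m (n - i) * gen_bernoulli (- m) i) =
      (\<Sum>i = 0..n. fact n * (fps_nth (?F powi m) i * fps_nth (?F powi (- m)) (n - i)))"
    by (rule sum.cong) (simp_all add: gen_bernoulli_def binomial_fact)
  also have "\<dots> = fact n * fps_nth (?F powi m * ?F powi (- m)) n"
    by (simp add: fps_mult_nth sum_distrib_left)
  also have "\<dots> = 0"
    using assms by (simp only: inv) simp
  finally show ?thesis .
qed

text \<open>
  Both sides count the ways to split n + k elements into three labelled blocks of sizes n - i,
  i and k.
\<close>
lemma binomial_mult_eq_trinomial:
  assumes "i \<le> n"
  shows "((n + k) choose (n - i)) * ((i + k) choose i) = ((n + k) choose k) * (n choose i)"
proof -
  have "(n + k) - (n - i) = i + k"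
    using assms by simp
  then have "(of_nat (((n + k) choose (n - i)) * ((i + k) choose i)) :: rat) =
      of_nat (((n + k) choose k) * (n choose i))"
    using assms by (simp add: binomial_fact add.commute)
  then show ?thesis
    by (simp only: of_nat_eq_iff)
qed

theorem theorem2p8:
  fixes k n :: nat
  assumes "n \<ge> 1"
  shows "of_nat ((n + k) choose k) * gen_bernoulli (- int k) n = of_nat (Stirling (n + k) k) \<and>
    (\<Sum>i = 0..n. of_nat ((n + k) choose (n - i)) * of_nat ((i + k) choose i)
       * gen_bernoulli (int k) (n - i) * gen_bernoulli (- int k) i) = 0"
proof
  show "of_nat ((n + k) choose k) * gen_bernoulli (- int k) n = of_nat (Stirling (n + k) k)"
    by (rule binomial_gen_bernoulli_eq_Stirling)
  have "(\<Sum>i = 0..n. of_nat ((n + k) choose (n - i)) * of_nat ((i + k) choose i)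
       * gen_bernoulli (int k) (n - i) * gen_bernoulli (- int k) i) =
     (\<Sum>i = 0..n. of_nat ((n + k) choose k) *
       (of_nat (n choose i) * gen_bernoulli (int k) (n - i) * gen_bernoulli (- int k) i))"
    by (rule sum.cong)
      (simp_all add: binomial_mult_eq_trinomial mult.assoc[symmetric] flip: of_nat_mult)
  also have "\<dots> = 0"
    using gen_bernoulli_convolution_eq_0[OF assms] by (simp flip: sum_distrib_left)
  finally show "(\<Sum>i = 0..n. of_nat ((n + k) choose (n - i)) * of_nat ((i + k) choose i)
       * gen_bernoulli (int k) (n - i) * gen_bernoulli (- int k) i) = 0" .
qed

end
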